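(* Let $n=4k$ with $k\equiv 1\pmod 4$, let $a\in\mathbb{F}_{3^4}\subseteq\mathbb{F}_{3^n}$ satisfy $a^4-a^2-1=0$, and let $a_1=a^5$, $a_2=a^{-5}$. Then $f:\mathbb{F}_{3^n}\to\mathbb{F}_3$, $f(x)=\operatorname{Tr}_n\big(a_1x^{2(3^k+1)}+a_2x^{(3^k+1)^2}\big)$, is a regular bent function of algebraic degree four belonging to the Maiorana–McFarland class.
   Context: $\operatorname{Tr}_n(x)=\sum_{i=0}^{n-1}x^{3^i}$. With $\omega=e^{2\pi i/3}$, $S_f(b)=\sum_{x\in\mathbb{F}_{3^n}}\omega^{f(x)-\operatorname{Tr}_n(bx)}$; $f$ is bent if $|S_f(b)|^2=3^n$ for all $b$, and regular bent if for all $b$, $3^{-n/2}S_f(b)=\omega^{f^*(b)}$ for some $f^*(b)\in\mathbb{F}_3$. Algebraic degree: maximal ternary digit sum of an exponent occurring. The Maiorana–McFarland class consists of functions $f(x,y)=x\cdot\pi(y)+g(y)$ on $\mathbb{F}_3^{2k}\times\mathbb{F}_3^{2k}$ with $\pi$ a permutation of $\mathbb{F}_3^{2k}$ and $g$ arbitrary; a function on $\mathbb{F}_{3^n}$ belongs to it if it has this form under some $\mathbb{F}_3$-linear identification of $\mathbb{F}_{3^n}$ with $\mathbb{F}_3^{2k}\times\mathbb{F}_3^{2k}$. *)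

theory Defs
  imports
    Complex_Main
    "HOL-Library.FuncSet"
    "HOL-Library.Cardinality"
    "HOL-Computational_Algebra.Polynomial"
begin

(* A field with 3^n elements is a type 'a :: {field, finite} with CARD('a) = 3 ^ n.
   Its subfields are subsets of it, so functions into F_3 are functions into 'a
   whose values lie in the prime field. *)

definition F3 :: "'a::field set" where
  "F3 = {0, 1, 2}"

definition subfield_of_order :: "nat \<Rightarrow> 'a::field set" where
  "subfield_of_order q = {x. x ^ q = x}"

definition Tr :: "nat \<Rightarrow> 'a::field \<Rightarrow> 'a" where
  "Tr n x = (\<Sum>i<n. x ^ (3 ^ i))"

definition omega :: complex where
  "omega = exp (2 * of_real pi * \<i> / 3)"

(* omega ^ c for c in F_3; the exponent is the representative of c in {0, 1, 2}. *)
definition omega_pow :: "'a::field \<Rightarrow> complex" where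
  "omega_pow c = omega ^ (LEAST j::nat. of_nat j = c)"

definition walsh :: "nat \<Rightarrow> ('a::{field, finite} \<Rightarrow> 'a) \<Rightarrow> 'a \<Rightarrow> complex" where
  "walsh n f b = (\<Sum>x\<in>UNIV. omega_pow (f x - Tr n (b * x)))"

definition bent :: "nat \<Rightarrow> ('a::{field, finite} \<Rightarrow> 'a) \<Rightarrow> bool" where
  "bent n f \<longleftrightarrow> (\<forall>b. (cmod (walsh n f b))\<^sup>2 = 3 ^ n)"

definition regular_bent :: "nat \<Rightarrow> ('a::{field, finite} \<Rightarrow> 'a) \<Rightarrow> bool" where
  "regular_bent n f \<longleftrightarrow> bent n f \<and>
     (\<forall>b. \<exists>c\<in>(F3 :: 'a set). of_real (3 powr (- real n / 2)) * walsh n f b = omega_pow c)"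

fun digit_sum3 :: "nat \<Rightarrow> nat" where
  "digit_sum3 e = (if e = 0 then 0 else e mod 3 + digit_sum3 (e div 3))"

declare digit_sum3.simps [simp del]

(* The exponents occurring in f are those of its reduced representation, the unique
   polynomial of degree less than the field size that represents f as a function. *)
definition reduced_poly :: "('a::{field, finite} \<Rightarrow> 'a) \<Rightarrow> 'a poly" where
  "reduced_poly f = (THE p. degree p < CARD('a) \<and> (\<forall>x. poly p x = f x))"

definition algebraic_degree :: "('a::{field, finite} \<Rightarrow> 'a) \<Rightarrow> nat" where
  "algebraic_degree f =
     Max (insert 0 (digit_sum3 ` {e. coeff (reduced_poly f) e \<noteq> 0}))"

lemma reduced_poly_ex1:
  fixes f :: "'a::{field, finite} \<Rightarrow> 'a"
  shows "\<exists>!p. degree p < CARD('a) \<and> (\<forall>x. poly p x = f x)"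
proof (rule ex_ex1I)
  define L where "L c = (\<Prod>d\<in>UNIV - {c}. smult (inverse (c - d)) [:- d, 1:])" for c :: 'a
  define p where "p = (\<Sum>c\<in>UNIV. smult (f c) (L c))"
  have "inverse (c - d) * (c - d) = 1" if "d \<noteq> c" for c d :: 'a
    using that by simp
  then have L: "poly (L c) x = (if x = c then 1 else 0)" for c x
    by (auto simp: L_def poly_prod prod_zero_iff algebra_simps intro!: prod.neutral)
  have degL: "degree (L c) \<le> CARD('a) - 1" for c
  proof -
    have "degree (L c) \<le> (\<Sum>d\<in>UNIV - {c}. degree (smult (inverse (c - d)) [:- d, 1:]))"
      unfolding L_def by (rule order.trans[OF degree_prod_sum_le]) (auto simp: o_def)
    also have "\<dots> \<le> (\<Sum>d\<in>UNIV - {c}. 1)"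
      by (intro sum_mono) (auto intro: order.trans[OF degree_smult_le])
    also have "\<dots> = CARD('a) - 1"
      by (simp add: card_Diff_singleton)
    finally show ?thesis .
  qed
  have "degree p \<le> CARD('a) - 1"
    unfolding p_def by (intro degree_sum_le order.trans[OF degree_smult_le degL]) auto
  then have "degree p < CARD('a)"
    using zero_less_card_finite[where 'a = 'a] by linarith
  moreover have "poly p x = f x" for x
    by (simp add: p_def poly_sum L if_distrib[where f = "(*) _"] cong: if_cong)
  ultimately show "\<exists>p. degree p < CARD('a) \<and> (\<forall>x. poly p x = f x)"
    by blast
next
  fix p q
  assume p: "degree p < CARD('a) \<and> (\<forall>x. poly p x = f x)"
    and q: "degree q < CARD('a) \<and> (\<forall>x. poly q x = f x)"
  show "p = q"
  proof (rule ccontr)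
    assume "p \<noteq> q"
    then have nz: "p - q \<noteq> 0" by simp
    have "{x. poly (p - q) x = 0} = UNIV" using p q by auto
    then have "CARD('a) \<le> degree (p - q)"
      using card_poly_roots_bound[OF nz] by simp
    with degree_diff_less[of p "CARD('a)" q] p q show False by auto
  qed
qed

(* F_3^m as functions on the index set {..<m}; linearity is stated coordinatewise. *)
definition vec3 :: "nat \<Rightarrow> (nat \<Rightarrow> 'a::field) set" where
  "vec3 m = {..<m} \<rightarrow>\<^sub>E F3"

definition F3_linear :: "nat \<Rightarrow> ('a::field \<Rightarrow> nat \<Rightarrow> 'a) \<Rightarrow> bool" where
  "F3_linear m L \<longleftrightarrow>
     (\<forall>z w. \<forall>i<m. L (z + w) i = L z i + L w i) \<and>
     (\<forall>c\<in>F3. \<forall>z. \<forall>i<m. L (c * z) i = c * L z i)"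

(* z \<mapsto> (X z, Y z) is the linear identification of the field with F_3^m \<times> F_3^m. *)
definition maiorana_mcfarland :: "nat \<Rightarrow> ('a::field \<Rightarrow> 'a) \<Rightarrow> bool" where
  "maiorana_mcfarland m f \<longleftrightarrow>
     (\<exists>X Y \<pi> g.
        bij_betw (\<lambda>z. (X z, Y z)) UNIV (vec3 m \<times> vec3 m) \<and>
        F3_linear m X \<and> F3_linear m Y \<and>
        bij_betw \<pi> (vec3 m) (vec3 m) \<and>
        g \<in> vec3 m \<rightarrow> F3 \<and>
        (\<forall>z. f z = (\<Sum>i<m. X z i * \<pi> (Y z) i) + g (Y z)))"

end

theory Submission
  imports Defs
begin

text \<open>
  Let \<open>q = 3^k\<close> and \<open>\<sigma> x = x^q\<close>. Put \<open>u = z + \<sigma>\<^sup>2 z\<close> and \<open>w = a (z - \<sigma>\<^sup>2 z)\<close>; since \<open>\<sigma> a = a^3\<close>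
  and \<open>\<sigma>\<^sup>2 a = - a\<close>, both lie in the subfield \<open>U\<close> of order \<open>q^2\<close>, and \<open>z \<mapsto> (w, u)\<close> identifies the
  field with \<open>U \<times> U\<close>. In these coordinates the quartic form collapses to
  \<open>f z = Tr\<^bsub>2k\<^esub> (w \<cdot> u (\<sigma> u)\<^sup>2)\<close>, and \<open>p u = u (\<sigma> u)\<^sup>2\<close> permutes \<open>U\<close> because
  \<open>(u \<sigma> u)^3 = p u \<cdot> \<sigma> (p u)\<close> and cubing is injective. An \<open>F\<^sub>3\<close>-basis of \<open>U\<close> and the nondegenerate
  trace form turn this into Maiorana--McFarland form, and summing over \<open>w\<close> evaluates the Walsh
  transform. All exponents of the reduced polynomial have digit sum four, and \<open>f\<close> is not zero
  because it is bent.
\<close>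

section \<open>Finite fields of characteristic three\<close>

text \<open>Multiplication by \<open>x \<noteq> 0\<close> permutes the nonzero elements, so their
  product absorbs the factor \<open>x\<close> raised to the number of them, which is therefore
  1.\<close>

lemma power_card_eq_self:
  fixes x :: "'a::{field, finite}"
  shows "x ^ CARD('a) = x"
proof (cases "x = 0")
  case True
  then show ?thesis by (simp add: zero_power)
next
  case False
  have "bij_betw ((*) x) (UNIV - {0}) (UNIV - {0})"
    using False by (intro bij_betw_byWitness[where f' = "\<lambda>y. y / x"]) auto
  then have eq: "(\<Prod>y\<in>UNIV - {0}. x * y) = \<Prod>(UNIV - {0})"
    by (rule prod.reindex_bij_betw)
  have "x ^ card (UNIV - {0::'a}) * \<Prod>(UNIV - {0}) = \<Prod>(UNIV - {0})"
    using eq unfolding prod.distrib prod_constant .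
  moreover have "\<Prod>(UNIV - {0::'a}) \<noteq> 0"
    by (subst prod_zero_iff) auto
  ultimately have "x ^ card (UNIV - {0::'a}) = 1"
    by (metis mult_cancel_right2)
  moreover have "CARD('a) = Suc (card (UNIV - {0::'a}))"
    by (rule card.remove) simp_all
  ultimately show ?thesis by (simp only: power_Suc mult_1_right)
qed

text \<open>Translation by 1 permutes the field, so comparing the sums of all elements makes the
  cardinality, a power of 3, vanish in the field.\<close>

lemma char3_of_card:
  assumes "CARD('a::{field, finite}) = 3 ^ n"
  shows "(3::'a) = 0"
proof -
  have "bij (\<lambda>x::'a. x + 1)"
    by (rule bij_betw_byWitness[where f' = "\<lambda>y. y - 1"]) auto
  then have "(\<Sum>x::'a\<in>UNIV. x + 1) = \<Sum>UNIV"
    by (rule sum.reindex_bij_betw)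
  then have "of_nat CARD('a) = (0::'a)"
    by (simp add: sum.distrib)
  then show ?thesis
    by (simp add: assms)
qed

lemma char3_two:
  assumes "(3::'a::field) = 0"
  shows "(2::'a) = - 1" "(2::'a) \<noteq> 0" "(2::'a) \<noteq> 1"
proof -
  show "(2::'a) = - 1"
    by (simp add: eq_neg_iff_add_eq_0 assms)
  then show "(2::'a) \<noteq> 0" by (simp only:) simp
  show "(2::'a) \<noteq> 1"
    by (metis add_cancel_left_left one_add_one zero_neq_one)
qed

lemma mem_F3_iff:
  assumes "(3::'a::field) = 0"
  shows "(x::'a) \<in> F3 \<longleftrightarrow> x ^ 3 = x"
proof -
  have "x ^ 3 - x = x * (x - 1) * (x - 2) + 3 * (x ^ 2 - x)"
    by algebra
  then have "x ^ 3 - x = 0 \<longleftrightarrow> x = 0 \<or> x = 1 \<or> x = 2"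
    by (simp add: assms)
  then show ?thesis by (simp add: F3_def)
qed

lemma power3_add:
  assumes "(3::'a::field) = 0"
  shows "(x + y :: 'a) ^ 3 ^ i = x ^ 3 ^ i + y ^ 3 ^ i"
proof (induction i)
  case (Suc i)
  have cube: "(s + t) ^ 3 = s ^ 3 + t ^ 3" for s t :: 'a
  proof -
    have "(s + t) ^ 3 = s ^ 3 + t ^ 3 + 3 * (s ^ 2 * t + s * t ^ 2)"
      by algebra
    then show ?thesis by (simp add: assms)
  qed
  show ?case
    by (simp add: power_mult mult.commute[of 3] Suc cube)
qed simp

lemma power3_minus: "(- x :: 'a::field) ^ 3 ^ i = - (x ^ 3 ^ i)"
  by (rule power_minus_odd) simp

lemma power3_diff:
  assumes "(3::'a::field) = 0"
  shows "(x - y :: 'a) ^ 3 ^ i = x ^ 3 ^ i - y ^ 3 ^ i"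
  using power3_add[OF assms, of x "- y" i] by (simp add: power3_minus)

lemma power3_inject:
  assumes "(3::'a::field) = 0" "(x::'a) ^ 3 = y ^ 3"
  shows "x = y"
  using power3_diff[OF assms(1), of x y 1] assms(2) by simp

lemma power_F3: "(3::'a::field) = 0 \<Longrightarrow> (x::'a) \<in> F3 \<Longrightarrow> x ^ 3 ^ i = x"
  by (induction i) (simp_all add: mem_F3_iff power_mult)

lemma F3_closed:
  assumes "(3::'a::field) = 0" "(x::'a) \<in> F3" "y \<in> F3"
  shows "x + y \<in> F3" "x - y \<in> F3" "x * y \<in> F3" "- x \<in> F3"
  using assms power3_add[OF assms(1), of x y 1] power3_diff[OF assms(1), of x y 1]
    power3_minus[of x 1]
  by (auto simp: mem_F3_iff power_mult_distrib)

lemma zero_mem_F3: "0 \<in> F3"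
  by (simp add: F3_def)

lemma card_F3:
  assumes "(3::'a::field) = 0"
  shows "card (F3 :: 'a set) = 3"
  using char3_two(2,3)[OF assms] by (simp add: F3_def)

lemma card_vec3:
  assumes "(3::'a::field) = 0"
  shows "card (vec3 m :: (nat \<Rightarrow> 'a) set) = 3 ^ m"
  by (simp add: vec3_def card_PiE card_F3[OF assms])

lemma finite_vec3: "finite (vec3 m)"
  by (simp add: vec3_def finite_PiE F3_def)


section \<open>The trace\<close>

lemma Tr_add: "(3::'a::field) = 0 \<Longrightarrow> Tr m (x + y :: 'a) = Tr m x + Tr m y"
  by (simp add: Tr_def power3_add sum.distrib)

lemma Tr_diff: "(3::'a::field) = 0 \<Longrightarrow> Tr m (x - y :: 'a) = Tr m x - Tr m y"
  by (simp add: Tr_def power3_diff sum_subtractf)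

lemma Tr_zero: "Tr m 0 = 0"
  by (simp add: Tr_def zero_power)

lemma Tr_sum: "(3::'a::field) = 0 \<Longrightarrow> Tr m (\<Sum>i\<in>I. h i :: 'a) = (\<Sum>i\<in>I. Tr m (h i))"
  by (induction I rule: infinite_finite_induct) (simp_all add: Tr_zero Tr_add)

lemma Tr_F3_mult: "(3::'a::field) = 0 \<Longrightarrow> c \<in> F3 \<Longrightarrow> Tr m (c * x :: 'a) = c * Tr m x"
  by (simp add: Tr_def power_mult_distrib power_F3 sum_distrib_left)

text \<open>Transitivity of the trace: the upper half of the Frobenius powers is the lower half
  applied to \<open>x ^ 3 ^ m\<close>. It serves both for the descent to \<open>U\<close> and for
  the descent to the subfield of order \<open>3 ^ k\<close>.\<close>

lemma Tr_double:
  assumes "(3::'a::field) = 0"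
  shows "Tr (2 * m) (x::'a) = Tr m (x + x ^ 3 ^ m)"
proof -
  have "(\<Sum>i<m + j. x ^ 3 ^ i) = (\<Sum>i<m. x ^ 3 ^ i) + (\<Sum>i<j. (x ^ 3 ^ m) ^ 3 ^ i)" for j
    by (induction j) (simp_all add: power_mult power_add add.assoc)
  from this[of m] show ?thesis
    unfolding Tr_add[OF assms] by (simp add: Tr_def mult_2)
qed

text \<open>Cubing permutes the summands cyclically, since the last one wraps around to
  \<open>x\<close>.\<close>

lemma Tr_mem_F3:
  assumes "(3::'a::field) = 0" "(x::'a) ^ 3 ^ m = x"
  shows "Tr m x \<in> F3"
proof -
  have "Tr m x ^ 3 = (\<Sum>i<m. x ^ 3 ^ Suc i)"
  proof -
    have "(\<Sum>i\<in>I. h i) ^ 3 = (\<Sum>i\<in>I. h i ^ 3)" for h :: "nat \<Rightarrow> 'a" and I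
      by (induction I rule: infinite_finite_induct)
        (simp_all add: power3_add[OF assms(1), of _ _ 1, simplified])
    then show ?thesis
      by (simp add: Tr_def mult.commute flip: power_mult)
  qed
  also have "\<dots> = Tr m x"
    using sum.lessThan_Suc_shift[of "\<lambda>i. x ^ 3 ^ i" m] assms(2)
    by (simp add: Tr_def add.commute)
  finally show ?thesis by (simp add: mem_F3_iff[OF assms(1)])
qed

text \<open>The trace is a nonzero polynomial of degree at most \<open>3 ^ (m - 1)\<close>, so it
  has too few roots to vanish on all of \<open>U\<close>.\<close>

lemma Tr_nonzero:
  fixes U :: "'a::field set"
  assumes "0 < m" "card U = 3 ^ m"
  shows "\<exists>x\<in>U. Tr m x \<noteq> 0"
proof (rule ccontr)
  assume contra: "\<not> ?thesis"
  define P where "P = (\<Sum>i<m. monom (1::'a) (3 ^ i))"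
  have P: "poly P x = Tr m x" for x
    by (simp add: P_def poly_sum poly_monom Tr_def)
  have "coeff P 1 = (\<Sum>i<m. if i = 0 then 1 else 0)"
    by (auto simp: P_def coeff_sum intro!: sum.cong)
  then have "coeff P 1 = 1"
    using assms(1) by simp
  then have "P \<noteq> 0" by auto
  have "degree P \<le> 3 ^ (m - 1)"
    unfolding P_def
    by (intro degree_sum_le order.trans[OF degree_monom_le] power_increasing) auto
  moreover have "card U \<le> card {x. poly P x = 0}"
    using contra poly_roots_finite[OF \<open>P \<noteq> 0\<close>] by (intro card_mono) (auto simp: P)
  moreover have "card {x. poly P x = 0} \<le> degree P"
    using card_poly_roots_bound[OF \<open>P \<noteq> 0\<close>] .
  moreover have "3 ^ (m - 1) < (3::nat) ^ m"
    using assms(1) by (intro power_strict_increasing) auto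
  ultimately show False using assms(2) by linarith
qed


section \<open>Bases over the prime field\<close>

text \<open>A longest independent family spans. Independence is expressed as injectivity of the
  combination map on \<open>vec3 m\<close>; the length \<open>m\<close> is identified only later, by
  counting.\<close>

lemma ex_F3_basis:
  fixes U :: "'a::field set"
  assumes char: "(3::'a) = 0" and fin: "finite U" and zero: "0 \<in> U"
    and add: "\<And>x y. x \<in> U \<Longrightarrow> y \<in> U \<Longrightarrow> x + y \<in> U"
    and scale: "\<And>c x. c \<in> F3 \<Longrightarrow> x \<in> U \<Longrightarrow> c * x \<in> U"
  obtains m e where "\<forall>i<m. e i \<in> U" "bij_betw (\<lambda>c. \<Sum>i<m. c i * e i) (vec3 m) U"
proof -
  define P where "P m \<longleftrightarrow> (\<exists>e. (\<forall>i<m. e i \<in> U) \<and> inj_on (\<lambda>c. \<Sum>i<m. c i * e i) (vec3 m))" for m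
  have comb: "(\<Sum>i<m. c i * e i) \<in> U" if "\<forall>i<m. e i \<in> U" "\<forall>i<m. c i \<in> F3" for m and c e :: "nat \<Rightarrow> 'a"
    using that by (induction m) (auto intro: zero add scale)
  \<comment> \<open>Injectivity gives \<open>3 ^ m \<le> card U\<close>; this crude consequence
    suffices for \<open>Greatest\<close> to be attained.\<close>
  have bound: "m \<le> card U" if "P m" for m
  proof -
    from that obtain e where e: "\<forall>i<m. e i \<in> U" "inj_on (\<lambda>c. \<Sum>i<m. c i * e i) (vec3 m)"
      by (auto simp: P_def)
    have "card (vec3 m :: (nat \<Rightarrow> 'a) set) \<le> card U"
      using e fin by (intro card_inj_on_le[OF e(2)]) (auto intro!: comb simp: vec3_def PiE_iff)
    moreover have "m < 3 ^ m" by (induction m) auto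
    ultimately show ?thesis by (simp add: card_vec3[OF char])
  qed
  have "P 0" by (simp add: P_def vec3_def)
  then have "P (Greatest P)" and max: "\<And>m. P m \<Longrightarrow> m \<le> Greatest P"
    using GreatestI_nat[of P 0 "card U"] Greatest_le_nat[of P _ "card U"] bound by blast+
  then obtain m e where m: "m = Greatest P" and e: "\<forall>i<m. e i \<in> U"
    and inj: "inj_on (\<lambda>c. \<Sum>i<m. c i * e i) (vec3 m)"
    by (auto simp: P_def)
  let ?C = "\<lambda>c. \<Sum>i<m. c i * e i"
  have "t \<in> ?C ` vec3 m" if "t \<in> U" for t
  \<comment> \<open>An element \<open>t\<close> outside the span could be appended to the family,
    contradicting maximality.\<close>
  proof (rule ccontr)
    assume t: "t \<notin> ?C ` vec3 m"
    have "inj_on (\<lambda>c. \<Sum>i<Suc m. c i * (e(m := t)) i) (vec3 (Suc m))"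
    proof (rule inj_onI)
      fix c d :: "nat \<Rightarrow> 'a"
      assume c: "c \<in> vec3 (Suc m)" and d: "d \<in> vec3 (Suc m)"
        and eq0: "(\<Sum>i<Suc m. c i * (e(m := t)) i) = (\<Sum>i<Suc m. d i * (e(m := t)) i)"
      have eq: "?C c + c m * t = ?C d + d m * t"
        using eq0 by simp
      have cF: "c i \<in> F3" and dF: "d i \<in> F3" if "i \<le> m" for i
        using c d that by (auto simp: vec3_def PiE_iff)
      have "c m = d m"
      proof (rule ccontr)
        assume ne: "c m \<noteq> d m"
        \<comment> \<open>A nonzero element of \<open>F3\<close> is its own inverse, so a nontrivial
          coefficient of \<open>t\<close> lets the relation be solved for \<open>t\<close>.\<close>
        define \<delta> where "\<delta> = c m - d m"
        have \<delta>: "\<delta> \<in> F3" "\<delta> \<noteq> 0"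
          using ne F3_closed(2)[OF char cF dF] by (auto simp: \<delta>_def)
        then have "\<delta> * (\<delta> * \<delta>) = \<delta> * 1"
          by (simp add: mem_F3_iff[OF char] power3_eq_cube)
        then have inv: "\<delta> * \<delta> = 1" using \<delta> by (simp only: mult_cancel_left) simp
        have "\<delta> * t = ?C d - ?C c"
          using eq by (simp add: \<delta>_def algebra_simps)
        then have "t = \<delta> * (?C d - ?C c)"
          using inv by (metis mult.assoc mult_1)
        also have "\<dots> = (\<Sum>i<m. \<delta> * (d i - c i) * e i)"
          by (simp add: sum_distrib_left sum_subtractf algebra_simps)
        \<comment> \<open>Members of \<open>vec3 m\<close> are extensional, so coefficient functions
          have to be restricted before they count as vectors.\<close>
        also have "\<dots> = ?C (restrict (\<lambda>i. \<delta> * (d i - c i)) {..<m})"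
          by (intro sum.cong) auto
        finally have "t = ?C (restrict (\<lambda>i. \<delta> * (d i - c i)) {..<m})" .
        moreover have "restrict (\<lambda>i. \<delta> * (d i - c i)) {..<m} \<in> vec3 m"
          unfolding vec3_def restrict_PiE_iff using \<delta> cF dF by (simp add: F3_closed[OF char])
        ultimately show False using t by blast
      qed
      moreover have "restrict c {..<m} = restrict d {..<m}"
      proof (rule inj_onD[OF inj])
        show "?C (restrict c {..<m}) = ?C (restrict d {..<m})"
          using eq \<open>c m = d m\<close> by simp
      qed (use cF dF in \<open>auto simp: vec3_def\<close>)
      then have "c i = d i" if "i < m" for i
        using that by (metis lessThan_iff restrict_apply')
      ultimately show "c = d"
        by (intro PiE_ext[OF c[unfolded vec3_def] d[unfolded vec3_def]]) (auto simp: less_Suc_eq)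
    qed
    then have "P (Suc m)"
      unfolding P_def using e \<open>t \<in> U\<close> by (intro exI[of _ "e(m := t)"]) auto
    with max[of "Suc m"] m show False by simp
  qed
  moreover have "?C ` vec3 m \<subseteq> U"
    using e by (auto intro!: comb simp: vec3_def PiE_iff)
  ultimately show ?thesis
    using that[of m e] e inj by (auto simp: bij_betw_def)
qed

text \<open>Here \<gamma> inverts the combination map; its additivity and homogeneity follow from
  the uniqueness of coefficients.\<close>

lemma F3_coordinates:
  fixes U :: "'a::field set"
  assumes char: "(3::'a) = 0"
    and e: "bij_betw (\<lambda>c. \<Sum>i<m. c i * e i) (vec3 m) U"
  obtains \<gamma> where "bij_betw \<gamma> U (vec3 m)"
    "\<And>x. x \<in> U \<Longrightarrow> x = (\<Sum>i<m. \<gamma> x i * e i)"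
    "\<And>x y i. \<lbrakk>x \<in> U; y \<in> U; x + y \<in> U; i < m\<rbrakk> \<Longrightarrow> \<gamma> (x + y) i = \<gamma> x i + \<gamma> y i"
    "\<And>(c::'a) x i. \<lbrakk>c \<in> F3; x \<in> U; c * x \<in> U; i < m\<rbrakk> \<Longrightarrow> \<gamma> (c * x) i = c * \<gamma> x i"
proof -
  let ?C = "\<lambda>c. \<Sum>i<m. c i * e i"
  define \<gamma> where "\<gamma> = inv_into (vec3 m) ?C"
  have \<gamma>: "bij_betw \<gamma> U (vec3 m)"
    unfolding \<gamma>_def using e by (rule bij_betw_inv_into)
  have sum: "x = ?C (\<gamma> x)" if "x \<in> U" for x
    using bij_betw_inv_into_right[OF e that] by (simp add: \<gamma>_def)
  have uniq: "\<gamma> (?C c) = c" if "c \<in> vec3 m" for c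
    using bij_betw_inv_into_left[OF e that] by (simp add: \<gamma>_def)
  have mem: "\<gamma> x i \<in> F3" if "x \<in> U" "i < m" for x i
    using bij_betwE[OF \<gamma>] that by (auto simp: vec3_def PiE_iff)
  have ext: "\<gamma> x i = c i" if "x = ?C c" "\<And>i. i < m \<Longrightarrow> c i \<in> F3" "i < m" for x c i
  proof -
    have "x = ?C (restrict c {..<m})" using that(1) by simp
    then have "\<gamma> x = restrict c {..<m}"
      using uniq[of "restrict c {..<m}"] that(2) by (simp add: vec3_def)
    then show ?thesis using that(3) by simp
  qed
  show ?thesis
  proof (rule that[OF \<gamma> sum])
    fix x y i assume x: "x \<in> U" and y: "y \<in> U" and i: "i < m"
    have "x + y = ?C (\<lambda>i. \<gamma> x i + \<gamma> y i)"
      by (subst sum[OF x], subst sum[OF y]) (simp add: sum.distrib algebra_simps)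
    then show "\<gamma> (x + y) i = \<gamma> x i + \<gamma> y i"
      by (rule ext) (use x y i mem F3_closed[OF char] in auto)
  next
    fix c x :: 'a and i assume c: "c \<in> F3" and x: "x \<in> U" and i: "i < m"
    have "c * x = ?C (\<lambda>i. c * \<gamma> x i)"
      by (subst sum[OF x]) (simp add: sum_distrib_left algebra_simps)
    then show "\<gamma> (c * x) i = c * \<gamma> x i"
      by (rule ext) (use c x i mem F3_closed[OF char] in auto)
  qed
qed


section \<open>The additive character\<close>

lemma omega_cube: "omega ^ 3 = 1"
proof -
  have "omega ^ 3 = exp (3 * (2 * of_real pi * \<i> / 3))"
    unfolding omega_def by (subst exp_of_nat_mult[symmetric]) simp
  also have "\<dots> = exp (2 * of_real pi * \<i>)"
    by (rule arg_cong[of _ _ exp]) simp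
  finally show ?thesis by (simp only: exp_two_pi_i)
qed

lemma omega_neq_1: "omega \<noteq> 1"
proof
  assume "omega = 1"
  then have "Im omega = 0" by simp
  then show False using sin_120 by (simp add: omega_def Im_exp)
qed

lemma omega_pow_F3:
  assumes "(3::'a::field) = 0"
  shows "omega_pow (0::'a) = 1" "omega_pow (1::'a) = omega" "omega_pow (2::'a) = omega ^ 2"
proof -
  note two = char3_two(2,3)[OF assms]
  have "(LEAST j. of_nat j = (0::'a)) = 0" by (rule Least_eq_0) simp
  then show "omega_pow (0::'a) = 1" by (simp add: omega_pow_def)
  have "(LEAST j. of_nat j = (1::'a)) = 1"
  proof (rule Least_equality)
    show "1 \<le> j" if "of_nat j = (1::'a)" for j
      using that by (cases j) auto
  qed simp
  then show "omega_pow (1::'a) = omega" by (simp add: omega_pow_def)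
  have "(LEAST j. of_nat j = (2::'a)) = 2"
  proof (rule Least_equality)
    fix j assume "of_nat j = (2::'a)"
    then have "j \<noteq> 0" "j \<noteq> 1"
      using two of_nat_0 of_nat_1 by metis+
    then show "2 \<le> j" by simp
  qed simp
  then show "omega_pow (2::'a) = omega ^ 2" by (simp add: omega_pow_def)
qed

lemma omega_pow_add:
  assumes char: "(3::'a::field) = 0" and "(x::'a) \<in> F3" "y \<in> F3"
  shows "omega_pow (x + y) = omega_pow x * omega_pow y"
proof -
  \<comment> \<open>These are the sums that wrap around modulo 3. The numeral rules are switched off
    below so that the simplifier meets the sums in this form.\<close>
  have arith: "(1::'a) + 2 = 0" "(2::'a) + 1 = 0" "(2::'a) + 2 = 1"
    by (simp_all add: char char3_two(1)[OF char])
  have "omega * omega ^ 2 = 1" "omega ^ 2 * omega ^ 2 = omega"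
    using omega_cube by algebra+
  then show ?thesis
    using assms(2,3)
    by (auto simp: F3_def omega_pow_F3[OF char] arith power2_eq_square mult.commute
        simp del: one_plus_numeral numeral_plus_one add_numeral_left numeral_plus_numeral)
qed

lemma omega_pow_eq_1_iff:
  assumes "(3::'a::field) = 0" "(x::'a) \<in> F3"
  shows "omega_pow x = 1 \<longleftrightarrow> x = 0"
proof -
  have "omega ^ 2 \<noteq> 1"
    using omega_cube omega_neq_1 by (metis mult_1 power2_eq_square power3_eq_cube)
  then show ?thesis
    using assms(2) omega_neq_1 char3_two(2)[OF assms(1)] by (auto simp: F3_def omega_pow_F3[OF assms(1)])
qed

lemma cmod_omega_pow: "cmod (omega_pow x) = 1"
  by (simp add: omega_pow_def omega_def norm_power norm_exp_eq_Re)


section \<open>Ternary digit sums\<close>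

text \<open>The induction splits off the least significant digit, in step with the recursion of
  \<open>digit_sum3\<close>.\<close>

lemma digit_sum3_expansion:
  "(\<And>j. j < m \<Longrightarrow> c j < 3) \<Longrightarrow> digit_sum3 (\<Sum>j<m. c j * 3 ^ j) = (\<Sum>j<m. c j)"
proof (induction m arbitrary: c)
  case 0
  then show ?case by (simp add: digit_sum3.simps)
next
  case (Suc m)
  let ?s = "\<Sum>j<m. c (Suc j) * 3 ^ j"
  have eq: "(\<Sum>j<Suc m. c j * 3 ^ j) = c 0 + 3 * ?s"
    by (simp only: sum.lessThan_Suc_shift) (simp add: sum_distrib_left mult_ac)
  have c0: "c 0 < 3" using Suc.prems by simp
  have "digit_sum3 (c 0 + 3 * ?s) = c 0 + digit_sum3 ?s"
    using c0 by (subst digit_sum3.simps) (auto simp: digit_sum3.simps[of 0])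
  also have "digit_sum3 ?s = (\<Sum>j<m. c (Suc j))"
    using Suc.prems by (intro Suc.IH) simp
  finally show ?case
    unfolding eq by (simp only: sum.lessThan_Suc_shift)
qed

lemma ternary_expansion_less:
  "(\<And>j. j < m \<Longrightarrow> c j < (3::nat)) \<Longrightarrow> (\<Sum>j<m. c j * 3 ^ j) < 3 ^ m"
proof (induction m)
  case (Suc m)
  have "(\<Sum>j<m. c j * 3 ^ j) < 3 ^ m"
    using Suc by simp
  moreover have "c m * 3 ^ m \<le> 2 * 3 ^ m"
    using Suc.prems[of m] by (intro mult_right_mono) auto
  ultimately have "(\<Sum>j<m. c j * 3 ^ j) + c m * 3 ^ m < 3 * 3 ^ m" by linarith
  then show ?case by simp
qed simp

text \<open>Padding with zero digits reduces a set of digit positions, in any order, to a full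
  expansion.\<close>

lemma digit_sum3_sparse:
  assumes "finite I" "I \<subseteq> {..<m}" "\<And>i. i \<in> I \<Longrightarrow> c i < 3"
  shows "digit_sum3 (\<Sum>i\<in>I. c i * 3 ^ i) = sum c I" "(\<Sum>i\<in>I. c i * 3 ^ i) < 3 ^ m"
proof -
  define d where "d j = (if j \<in> I then c j else 0)" for j
  have "(\<Sum>i\<in>I. c i * 3 ^ i) = (\<Sum>j<m. d j * 3 ^ j)" "sum c I = (\<Sum>j<m. d j)"
    using assms(2) by (intro sum.mono_neutral_cong_left; auto simp: d_def)+
  moreover have "d j < 3" for j using assms(3) by (simp add: d_def)
  ultimately show "digit_sum3 (\<Sum>i\<in>I. c i * 3 ^ i) = sum c I" "(\<Sum>i\<in>I. c i * 3 ^ i) < 3 ^ m"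
    using digit_sum3_expansion[of m d] ternary_expansion_less[of m d] by auto
qed

section \<open>The quartic form over the subfield of order \<open>3^k\<close>\<close>

locale quartic_field =
  fixes k :: nat and a :: "'a::{field, finite}"
  assumes card: "CARD('a) = 3 ^ (4 * k)"
    and k_mod: "k mod 4 = 1"
    and a_pow4: "a ^ 4 = a ^ 2 + 1"
begin

definition \<sigma> :: "'a \<Rightarrow> 'a" where "\<sigma> x = x ^ 3 ^ k"

definition U :: "'a set" where "U = {x. \<sigma> (\<sigma> x) = x}"

abbreviation T :: "'a \<Rightarrow> 'a" where "T \<equiv> Tr (2 * k)"

definition u :: "'a \<Rightarrow> 'a" where "u z = z + \<sigma> (\<sigma> z)"

definition w :: "'a \<Rightarrow> 'a" where "w z = a * (z - \<sigma> (\<sigma> z))"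

definition p :: "'a \<Rightarrow> 'a" where "p x = x * (\<sigma> x)\<^sup>2"

definition F :: "'a \<Rightarrow> 'a" where
  "F z = Tr (4 * k) (a ^ 5 * z ^ (2 * (3 ^ k + 1)) + a powi (- 5) * z ^ ((3 ^ k + 1) ^ 2))"

section \<open>The automorphism \<sigma> and its action on \<open>a\<close>\<close>

lemmas char = char3_of_card[OF card]

lemma k_pos: "0 < k"
  using k_mod by (cases k) auto

lemma \<sigma>_add: "\<sigma> (x + y) = \<sigma> x + \<sigma> y"
  and \<sigma>_diff: "\<sigma> (x - y) = \<sigma> x - \<sigma> y"
  and \<sigma>_minus: "\<sigma> (- x) = - \<sigma> x"
  and \<sigma>_mult: "\<sigma> (x * y) = \<sigma> x * \<sigma> y"
  and \<sigma>_divide: "\<sigma> (x / y) = \<sigma> x / \<sigma> y"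
  and \<sigma>_power: "\<sigma> (x ^ j) = \<sigma> x ^ j"
  and \<sigma>_zero: "\<sigma> 0 = 0"
  by (simp_all add: \<sigma>_def power3_add[OF char] power3_diff[OF char] power3_minus
      power_mult_distrib power_divide zero_power power_commutes flip: power_mult)
    (simp add: mult.commute)

lemmas \<sigma>_hom = \<sigma>_add \<sigma>_diff \<sigma>_minus \<sigma>_mult \<sigma>_divide \<sigma>_power

lemma \<sigma>_F3: "c \<in> F3 \<Longrightarrow> \<sigma> c = c"
  by (simp add: \<sigma>_def power_F3[OF char])

lemma \<sigma>_twice: "\<sigma> (\<sigma> x) = x ^ 3 ^ (2 * k)"
  by (simp add: \<sigma>_def mult_2 power_add flip: power_mult)

lemma power_card: "x ^ 3 ^ (4 * k) = (x::'a)"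
  using power_card_eq_self[of x] by (simp add: card)

lemma \<sigma>_four: "\<sigma> (\<sigma> (\<sigma> (\<sigma> x))) = x"
proof -
  have "\<sigma> (\<sigma> (\<sigma> (\<sigma> x))) = x ^ 3 ^ (2 * k + 2 * k)"
    by (simp only: \<sigma>_twice power_add power_mult)
  also have "2 * k + 2 * k = 4 * k" by simp
  finally show ?thesis by (simp only: power_card)
qed

lemma a_pow8: "a ^ 8 = - 1"
proof -
  have "a ^ 8 = (a ^ 4) ^ 2" by simp
  also have "\<dots> = - 1 + 3 * (a ^ 2 + 1)"
    using a_pow4 by algebra
  finally show ?thesis by (simp add: char)
qed

lemma a_nonzero: "a \<noteq> 0"
  using a_pow4 by auto

text \<open>From \<open>a ^ 8 = - 1\<close> follows \<open>a ^ 81 = a\<close>, and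
  \<open>k mod 4 = 1\<close> makes \<open>3 ^ k\<close> equal to 3 times a power of 81.\<close>

lemma \<sigma>_a: "\<sigma> a = a ^ 3"
proof -
  have "a ^ 81 = a * (a ^ 8) ^ 10" by algebra
  then have a81: "a ^ 81 = a" by (simp add: a_pow8)
  have "a ^ 81 ^ j = a" for j
    by (induction j) (simp_all add: power_mult a81)
  moreover have power3: "(3::nat) ^ (4 * j + 1) = 81 ^ j * 3" for j
    by (simp add: power_mult)
  have "k = 4 * (k div 4) + 1"
    using k_mod by presburger
  then have "(3::nat) ^ k = 81 ^ (k div 4) * 3"
    using power3 by metis
  ultimately show ?thesis
    by (simp add: \<sigma>_def power_mult)
qed

lemma \<sigma>_a3: "\<sigma> (a ^ 3) = - a"
proof -
  have "\<sigma> (a ^ 3) = a * a ^ 8"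
    unfolding \<sigma>_power \<sigma>_a by algebra
  then show ?thesis by (simp add: a_pow8)
qed

lemma \<sigma>_\<sigma>_a: "\<sigma> (\<sigma> a) = - a"
  by (simp only: \<sigma>_a \<sigma>_a3)

section \<open>Collapse of the quartic form\<close>

lemma Tr_full: "Tr (4 * k) (x::'a) = T (x + \<sigma> (\<sigma> x))"
  using Tr_double[OF char, of "2 * k" x] by (simp add: \<sigma>_twice)

lemma T_eq: "T x = Tr k (x + \<sigma> x)"
  using Tr_double[OF char, of k x] by (simp add: \<sigma>_def)

text \<open>Both sides are traces from the subfield of order \<open>3 ^ k\<close>, so it suffices to
  compare the relative traces of the arguments \<open>y\<close> and \<open>v\<close> down to that
  subfield, as polynomials in the conjugates of \<open>z\<close>.\<close>

lemma F_eq: "F z = T (w z * p (u z))"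
proof -
  define c where "c = a ^ 3"
  have \<sigma>a: "\<sigma> a = c" and \<sigma>c: "\<sigma> c = - a"
    by (simp_all only: c_def \<sigma>_a \<sigma>_a3)
  \<comment> \<open>On these conjugates \<sigma> is a 4-cycle, while it sends \<open>a\<close> to
    \<open>c\<close> and \<open>c\<close> to \<open>- a\<close>.\<close>
  define x0 x1 x2 x3 where "x0 = z" and "x1 = \<sigma> x0" and "x2 = \<sigma> x1" and "x3 = \<sigma> x2"
  have \<sigma>x: "\<sigma> x0 = x1" "\<sigma> x1 = x2" "\<sigma> x2 = x3" "\<sigma> x3 = x0"
    by (simp_all add: x0_def x1_def x2_def x3_def \<sigma>_four)
  have a5: "a ^ 5 = c + a"
    unfolding c_def using a_pow4 by algebra
  have "a ^ 5 * (- c) = 1"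
    unfolding c_def using a_pow8 by algebra
  then have a5': "a powi (- 5) = - c"
    by (simp add: power_int_minus inverse_unique)
  have e1: "z ^ (2 * (3 ^ k + 1)) = x0\<^sup>2 * x1\<^sup>2"
    by (simp add: x0_def x1_def \<sigma>_def power_add power_mult power2_eq_square power_mult_distrib
        mult.commute[of 2])
  have "((3::nat) ^ k + 1) ^ 2 = 1 + 3 ^ k + 3 ^ k + 3 ^ (2 * k)"
    by (simp add: power2_eq_square mult_2 power_add)
  then have e2: "z ^ ((3 ^ k + 1) ^ 2) = x0 * x1\<^sup>2 * x2"
    by (simp only: power_add \<sigma>_twice[symmetric])
      (simp add: x0_def x1_def x2_def \<sigma>_def power2_eq_square)
  define y where "y = (c + a) * (x0\<^sup>2 * x1\<^sup>2) + (- c) * (x0 * x1\<^sup>2 * x2)"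
  define v where "v = w z * p (u z)"
  have v: "v = a * (x0 - x2) * ((x0 + x2) * (x1 + x3)\<^sup>2)"
    by (simp add: v_def w_def p_def u_def \<sigma>x \<sigma>_hom flip: x0_def)
  have \<sigma>v: "\<sigma> v = c * (x1 - x3) * ((x1 + x3) * (x2 + x0)\<^sup>2)"
    by (simp add: v \<sigma>_hom \<sigma>x \<sigma>a)
  have \<sigma>y: "\<sigma> y = (- a + c) * (x1\<^sup>2 * x2\<^sup>2) + a * (x1 * x2\<^sup>2 * x3)"
    by (simp add: y_def \<sigma>_hom \<sigma>x \<sigma>a \<sigma>c)
  have \<sigma>\<sigma>y: "\<sigma> (\<sigma> y) = (- c - a) * (x2\<^sup>2 * x3\<^sup>2) + c * (x2 * x3\<^sup>2 * x0)"
    by (simp add: \<sigma>y \<sigma>_hom \<sigma>x \<sigma>a \<sigma>c)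
  have \<sigma>\<sigma>\<sigma>y: "\<sigma> (\<sigma> (\<sigma> y)) = (a - c) * (x3\<^sup>2 * x0\<^sup>2) - a * (x3 * x0\<^sup>2 * x1)"
    by (simp add: \<sigma>\<sigma>y \<sigma>_hom \<sigma>x \<sigma>a \<sigma>c)
  \<comment> \<open>The identity holds modulo 3 only; the explicit multiple of 3 makes it a plain
    polynomial identity. Nested images are unfolded from the outermost in, before their inner parts
    are rewritten.\<close>
  have "y + \<sigma> (\<sigma> y) + (\<sigma> y + \<sigma> (\<sigma> (\<sigma> y)))
      + 3 * (a * x1 * x3 * (x0\<^sup>2 - x2\<^sup>2) + c * x0 * x2 * (x1\<^sup>2 - x3\<^sup>2)) = v + \<sigma> v"
    unfolding \<sigma>\<sigma>\<sigma>y unfolding \<sigma>\<sigma>y unfolding \<sigma>y \<sigma>v unfolding y_def v by algebra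
  then have "y + \<sigma> (\<sigma> y) + (\<sigma> y + \<sigma> (\<sigma> (\<sigma> y))) = v + \<sigma> v"
    by (simp add: char)
  then have "Tr (4 * k) y = T v"
    by (simp add: Tr_full T_eq \<sigma>_add)
  then show ?thesis
    by (simp only: F_def a5 a5' e1 e2 y_def v_def)
qed


section \<open>The subfield of order \<open>3^(2 k)\<close>\<close>

lemma U_add: "x \<in> U \<Longrightarrow> y \<in> U \<Longrightarrow> x + y \<in> U"
  and U_diff: "x \<in> U \<Longrightarrow> y \<in> U \<Longrightarrow> x - y \<in> U"
  and U_minus: "x \<in> U \<Longrightarrow> - x \<in> U"
  and U_mult: "x \<in> U \<Longrightarrow> y \<in> U \<Longrightarrow> x * y \<in> U"
  and U_divide: "x \<in> U \<Longrightarrow> y \<in> U \<Longrightarrow> x / y \<in> U"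
  and U_power: "x \<in> U \<Longrightarrow> x ^ j \<in> U"
  and U_\<sigma>: "x \<in> U \<Longrightarrow> \<sigma> x \<in> U"
  and U_F3: "c \<in> F3 \<Longrightarrow> c \<in> U"
  and U_zero: "0 \<in> U"
  by (simp_all add: U_def \<sigma>_hom \<sigma>_zero \<sigma>_F3)

text \<open>The square of \<sigma> swaps the summands of \<open>u z\<close>; in \<open>w z\<close>
  both \<open>a\<close> and the difference change sign.\<close>

lemma u_mem: "u z \<in> U" and w_mem: "w z \<in> U"
  by (simp_all add: U_def u_def w_def \<sigma>_hom \<sigma>_four \<sigma>_\<sigma>_a algebra_simps)

lemma p_mem: "x \<in> U \<Longrightarrow> p x \<in> U"
  by (simp add: p_def U_mult U_\<sigma> U_power)

lemma T_mem: "x \<in> U \<Longrightarrow> T x \<in> F3"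
  by (rule Tr_mem_F3[OF char]) (simp add: U_def flip: \<sigma>_twice)

text \<open>The inverse comes from \<open>u z + w z / a = 2 * z = - z\<close>.\<close>

lemma split_bij: "bij_betw (\<lambda>z. (w z, u z)) UNIV (U \<times> U)"
proof (rule bij_betw_byWitness[where f' = "\<lambda>(y, x). - (x + y / a)"])
  have double: "- (x + x) = x" for x :: 'a
  proof -
    have "- (x + x) = x - 3 * x" by algebra
    then show ?thesis by (simp add: char)
  qed
  show "\<forall>z\<in>UNIV. (case (w z, u z) of (y, x) \<Rightarrow> - (x + y / a)) = z"
    using a_nonzero double by (simp add: w_def u_def)
  show "\<forall>yx\<in>U \<times> U. (w (case yx of (y, x) \<Rightarrow> - (x + y / a)), u (case yx of (y, x) \<Rightarrow> - (x + y / a))) = yx"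
  proof clarify
    fix y x assume yx: "y \<in> U" "x \<in> U"
    let ?z = "- (x + y / a)"
    have ssz: "\<sigma> (\<sigma> ?z) = - (x - y / a)"
      using yx by (simp add: \<sigma>_hom \<sigma>_\<sigma>_a U_def)
    have "u ?z = - (x + x)"
      unfolding u_def ssz by simp
    moreover have "w ?z = a * (- (y / a + y / a))"
      unfolding w_def ssz by simp
    ultimately show "w ?z = y \<and> u ?z = x"
      unfolding double using a_nonzero by simp
  qed
qed (auto simp: u_mem w_mem)

lemma card_U: "card U = 3 ^ (2 * k)"
proof -
  have "card U * card U = 3 ^ (4 * k)"
    using bij_betw_same_card[OF split_bij] by (simp add: card card_cartesian_product)
  also have "\<dots> = (3 ^ (2 * k)) * (3::nat) ^ (2 * k)"
    by (simp flip: power_add)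
  finally show ?thesis
    by (metis power2_eq_square power2_eq_iff_nonneg zero_le)
qed

text \<open>If \<open>t \<noteq> 0\<close>, its multiples by elements of \<open>U\<close> exhaust
  \<open>U\<close>, where \<open>T\<close> is not identically zero.\<close>

lemma T_nondegenerate:
  assumes "t \<in> U" "\<And>x. x \<in> U \<Longrightarrow> T (x * t) = 0"
  shows "t = 0"
proof (rule ccontr)
  assume "t \<noteq> 0"
  obtain x where "x \<in> U" "T x \<noteq> 0"
    using Tr_nonzero[OF _ card_U] k_pos by auto
  then show False
    using assms(2)[of "x / t"] assms(1) \<open>t \<noteq> 0\<close> by (simp add: U_divide)
qed

lemma p_bij: "bij_betw p U U"
proof -
  have "inj_on p U"
  proof (rule inj_onI)
    fix x y assume x: "x \<in> U" and y: "y \<in> U" and eq: "p x = p y"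
    \<comment> \<open>The norm \<open>t * \<sigma> t\<close> is thus determined by
      \<open>p t\<close>; as \<open>p t\<close> is the norm times \<open>\<sigma> t\<close>, a
      nonzero norm can be cancelled to recover \<open>t\<close>.\<close>
    have norm: "(t * \<sigma> t) ^ 3 = p t * \<sigma> (p t)" if "t \<in> U" for t
      using that by (simp add: p_def \<sigma>_hom U_def power2_eq_square power3_eq_cube mult_ac)
    have zero: "t = 0" if "\<sigma> t = 0" for t
      using \<sigma>_four[of t] that by (simp add: \<sigma>_zero)
    have "(x * \<sigma> x) ^ 3 = (y * \<sigma> y) ^ 3"
      by (simp only: norm x y eq)
    then have N: "x * \<sigma> x = y * \<sigma> y"
      by (rule power3_inject[OF char])
    show "x = y"
    proof (cases "x * \<sigma> x = 0")
      case True
      then have "x = 0" "y = 0"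
        using N zero by auto
      then show ?thesis by simp
    next
      case False
      have "(x * \<sigma> x) * \<sigma> x = (y * \<sigma> y) * \<sigma> y"
        using eq by (simp add: p_def power2_eq_square mult.assoc)
      also have "\<dots> = (x * \<sigma> x) * \<sigma> y"
        by (simp only: N)
      finally have "(x * \<sigma> x) * \<sigma> x = (x * \<sigma> x) * \<sigma> y" .
      then have "\<sigma> x = \<sigma> y" using False by simp
      then have "\<sigma> (\<sigma> x) = \<sigma> (\<sigma> y)" by simp
      then show ?thesis using x y by (simp add: U_def)
    qed
  qed
  moreover have "p ` U \<subseteq> U" using p_mem by auto
  ultimately show ?thesis
    by (simp add: bij_betw_def endo_inj_surj)
qed


section \<open>Maiorana--McFarland form\<close>

lemma maiorana_mcfarland_F: "maiorana_mcfarland (2 * k) F"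
proof -
  obtain m e where e: "\<forall>i<m. e i \<in> U" and bij: "bij_betw (\<lambda>c. \<Sum>i<m. c i * e i) (vec3 m) U"
    by (rule ex_F3_basis[OF char, of U]) (auto intro: U_zero U_add U_mult U_F3)
  have "3 ^ m = (3::nat) ^ (2 * k)"
    using bij_betw_same_card[OF bij] by (simp add: card_vec3[OF char] card_U)
  then have m: "2 * k = m" by simp
  let ?C = "\<lambda>c. \<Sum>i<m. c i * e i"
  obtain \<gamma> where \<gamma>: "bij_betw \<gamma> U (vec3 m)" and \<gamma>_sum: "\<And>x. x \<in> U \<Longrightarrow> x = ?C (\<gamma> x)"
    and \<gamma>_add: "\<And>x y i. \<lbrakk>x \<in> U; y \<in> U; x + y \<in> U; i < m\<rbrakk> \<Longrightarrow> \<gamma> (x + y) i = \<gamma> x i + \<gamma> y i"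
    and \<gamma>_scale: "\<And>c x i. \<lbrakk>c \<in> F3; x \<in> U; c * x \<in> U; i < m\<rbrakk> \<Longrightarrow> \<gamma> (c * x) i = c * \<gamma> x i"
    using F3_coordinates[OF char bij] by blast
  have \<gamma>_mem: "\<gamma> x i \<in> F3" if "x \<in> U" "i < m" for x i
    using bij_betwE[OF \<gamma>] that by (auto simp: vec3_def PiE_iff)
  \<comment> \<open>These are the coordinates with respect to the trace-dual basis, so that
    \<open>T (x * t)\<close> becomes the dot product of \<open>\<gamma> x\<close> and
    \<open>\<tau> t\<close>.\<close>
  define \<tau> where "\<tau> t = restrict (\<lambda>i. T (e i * t)) {..<m}" for t
  have \<tau>_mem: "\<tau> t \<in> vec3 m" if "t \<in> U" for t
    unfolding \<tau>_def vec3_def restrict_PiE_iff using that e by (simp add: T_mem U_mult)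
  have "inj_on \<tau> U"
  proof (rule inj_onI)
    fix s t assume s: "s \<in> U" and t: "t \<in> U" and eq: "\<tau> s = \<tau> t"
    have e0: "T (e i * (s - t)) = 0" if "i < m" for i
      using fun_cong[OF eq, of i] that by (simp add: \<tau>_def Tr_diff[OF char] right_diff_distrib)
    have "T (x * (s - t)) = 0" if x: "x \<in> U" for x
    proof -
      have "T (x * (s - t)) = T (\<Sum>i<m. \<gamma> x i * (e i * (s - t)))"
        by (subst \<gamma>_sum[OF x]) (simp add: sum_distrib_right mult.assoc)
      also have "\<dots> = 0"
        using x by (simp add: Tr_sum[OF char] Tr_F3_mult[OF char \<gamma>_mem] e0)
      finally show ?thesis .
    qed
    then have "s - t = 0" by (rule T_nondegenerate[OF U_diff[OF s t]])
    then show "s = t" by simp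
  qed
  moreover have "card (\<tau> ` U) = card (vec3 m :: (nat \<Rightarrow> 'a) set)"
    using \<open>inj_on \<tau> U\<close> by (simp add: card_image card_U card_vec3[OF char] m)
  then have "\<tau> ` U = vec3 m"
    using \<tau>_mem by (intro card_subset_eq finite_vec3) auto
  ultimately have \<tau>: "bij_betw \<tau> U (vec3 m)"
    by (simp add: bij_betw_def)
  \<comment> \<open>The second argument is decoded into \<open>U\<close>, permuted by
    \<open>p\<close> and read in dual coordinates; the summand \<open>g\<close> is then
    zero.\<close>
  define \<pi> where "\<pi> = \<tau> \<circ> p \<circ> ?C"
  have "bij_betw \<pi> (vec3 m) (vec3 m)"
    unfolding \<pi>_def by (intro bij_betw_trans[OF bij] bij_betw_trans[OF p_bij] \<tau>)
  moreover have "bij_betw (\<lambda>z. (\<gamma> (w z), \<gamma> (u z))) UNIV (vec3 m \<times> vec3 m)"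
    using bij_betw_trans[OF split_bij bij_betw_map_prod[OF \<gamma> \<gamma>]] by (simp add: o_def)
  moreover have "w (z + z') = w z + w z'" "u (z + z') = u z + u z'" for z z'
    by (simp_all add: w_def u_def \<sigma>_add algebra_simps)
  then have "\<gamma> (w (z + z')) i = \<gamma> (w z) i + \<gamma> (w z') i" "\<gamma> (u (z + z')) i = \<gamma> (u z) i + \<gamma> (u z') i"
    if "i < m" for z z' i
    using that by (simp_all add: \<gamma>_add u_mem w_mem U_add)
  moreover have "w (c * z) = c * w z" "u (c * z) = c * u z" if "c \<in> F3" for c z
    using that by (simp_all add: w_def u_def \<sigma>_mult \<sigma>_F3 algebra_simps)
  then have "\<gamma> (w (c * z)) i = c * \<gamma> (w z) i" "\<gamma> (u (c * z)) i = c * \<gamma> (u z) i"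
    if "c \<in> F3" "i < m" for c z i
    using that by (simp_all add: \<gamma>_scale u_mem w_mem U_mult U_F3)
  ultimately have "F3_linear m (\<lambda>z. \<gamma> (w z))" "F3_linear m (\<lambda>z. \<gamma> (u z))"
    by (simp_all add: F3_linear_def)
  moreover have "F z = (\<Sum>i<m. \<gamma> (w z) i * \<pi> (\<gamma> (u z)) i)" for z
  proof -
    have "F z = T (\<Sum>i<m. \<gamma> (w z) i * (e i * p (u z)))"
      unfolding F_eq by (subst \<gamma>_sum[OF w_mem]) (simp add: sum_distrib_right mult.assoc)
    also have "\<dots> = (\<Sum>i<m. \<gamma> (w z) i * T (e i * p (u z)))"
      by (simp add: Tr_sum[OF char] Tr_F3_mult[OF char \<gamma>_mem] w_mem)
    finally show ?thesis
      by (simp add: \<pi>_def \<tau>_def flip: \<gamma>_sum[OF u_mem])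
  qed
  ultimately show ?thesis
    unfolding maiorana_mcfarland_def m
    using \<open>bij_betw \<pi> _ _\<close> \<open>bij_betw (\<lambda>z. (\<gamma> (w z), \<gamma> (u z))) _ _\<close>
    by (intro exI[of _ "\<lambda>z. \<gamma> (w z)"] exI[of _ "\<lambda>z. \<gamma> (u z)"] exI[of _ \<pi>] exI[of _ "\<lambda>_. 0"])
      (simp add: zero_mem_F3)
qed


section \<open>The Walsh transform\<close>

text \<open>Orthogonality of additive characters: a translation by \<open>y\<close> with nontrivial
  character value multiplies the sum by that value, which forces it to vanish.\<close>

lemma character_sum:
  assumes t: "t \<in> U"
  shows "(\<Sum>x\<in>U. omega_pow (T (x * t))) = (if t = 0 then 3 ^ (2 * k) else 0)"
proof (cases "t = 0")
  case True
  then show ?thesis by (simp add: Tr_zero omega_pow_F3[OF char] card_U)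
next
  case False
  then obtain y where y: "y \<in> U" "T (y * t) \<noteq> 0"
    using T_nondegenerate[OF t] by blast
  let ?S = "\<Sum>x\<in>U. omega_pow (T (x * t))"
  have "bij_betw (\<lambda>x. x + y) U U"
    using y(1) by (intro bij_betw_byWitness[where f' = "\<lambda>x. x - y"]) (auto intro: U_add U_diff)
  then have "?S = (\<Sum>x\<in>U. omega_pow (T ((x + y) * t)))"
    by (rule sum.reindex_bij_betw[symmetric])
  also have "\<dots> = (\<Sum>x\<in>U. omega_pow (T (x * t)) * omega_pow (T (y * t)))"
    using t y(1)
    by (intro sum.cong refl)
      (simp add: distrib_right Tr_add[OF char] omega_pow_add[OF char T_mem T_mem] U_mult)
  also have "\<dots> = ?S * omega_pow (T (y * t))"
    by (simp add: sum_distrib_right)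
  finally have "?S * (omega_pow (T (y * t)) - 1) = 0"
    by (simp add: algebra_simps)
  moreover have "omega_pow (T (y * t)) \<noteq> 1"
    using t y by (simp add: omega_pow_eq_1_iff[OF char T_mem] U_mult)
  ultimately show ?thesis using False by simp
qed

text \<open>The exponent is linear in the coordinate \<open>w z\<close>, so summing over it leaves
  only the unique \<open>x\<close> with \<open>p x = \<beta>\<close>; the dual value at
  \<open>b\<close> is \<open>T (- (x * \<gamma>))\<close>.\<close>

lemma walsh_F: "\<exists>c\<in>(F3 :: 'a set). walsh (4 * k) F b = 3 ^ (2 * k) * omega_pow c"
proof -
  define b2 where "b2 = \<sigma> (\<sigma> b)"
  \<comment> \<open>Chosen so that \<open>w z * \<beta> + u z * \<gamma>\<close> is the relative
    trace of \<open>b * z\<close> down to \<open>U\<close>: the mixed terms cancel and the factor -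
    2 equals 1.\<close>
  define \<beta> \<gamma> where "\<beta> = (b2 - b) / a" and "\<gamma> = - (b + b2)"
  have \<beta>: "\<beta> \<in> U" and \<gamma>: "\<gamma> \<in> U"
    using a_nonzero
    by (simp_all add: U_def \<beta>_def \<gamma>_def b2_def \<sigma>_hom \<sigma>_four \<sigma>_\<sigma>_a field_simps)
  let ?G = "\<lambda>(y, x). omega_pow (T (y * (p x - \<beta>))) * omega_pow (T (- (x * \<gamma>)))"
  have "omega_pow (F z - Tr (4 * k) (b * z)) = ?G (w z, u z)" for z
  proof -
    let ?z2 = "\<sigma> (\<sigma> z)"
    have "w z * \<beta> = (z - ?z2) * (b2 - b)"
      using a_nonzero by (simp add: w_def \<beta>_def)
    then have "w z * \<beta> + u z * \<gamma> = b * z + b2 * ?z2 - 3 * (b * z + b2 * ?z2)"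
      unfolding u_def \<gamma>_def by algebra
    then have "b * z + \<sigma> (\<sigma> (b * z)) = w z * \<beta> + u z * \<gamma>"
      by (simp add: char \<sigma>_mult b2_def)
    then have "F z - Tr (4 * k) (b * z) = T (w z * p (u z)) - T (w z * \<beta> + u z * \<gamma>)"
      by (simp add: F_eq Tr_full)
    also have "\<dots> = T (w z * (p (u z) - \<beta>) + - (u z * \<gamma>))"
      by (simp add: algebra_simps flip: Tr_diff[OF char])
    finally have eq: "F z - Tr (4 * k) (b * z) = T (w z * (p (u z) - \<beta>)) + T (- (u z * \<gamma>))"
      by (simp only: Tr_add[OF char])
    show ?thesis
      unfolding eq prod.case
      by (intro omega_pow_add[OF char] T_mem U_mult U_diff U_minus p_mem u_mem w_mem \<beta> \<gamma>)
  qed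
  then have "walsh (4 * k) F b = (\<Sum>z\<in>UNIV. ?G (w z, u z))"
    by (simp only: walsh_def)
  also have "\<dots> = (\<Sum>yx\<in>U \<times> U. ?G yx)"
    by (rule sum.reindex_bij_betw[OF split_bij])
  also have "\<dots> = (\<Sum>y\<in>U. \<Sum>x\<in>U. omega_pow (T (y * (p x - \<beta>))) * omega_pow (T (- (x * \<gamma>))))"
    by (rule sum.cartesian_product[symmetric])
  \<comment> \<open>The order of summation is exchanged so that the inner sum is a character sum in
    \<open>y\<close>.\<close>
  also have "\<dots> = (\<Sum>x\<in>U. (\<Sum>y\<in>U. omega_pow (T (y * (p x - \<beta>)))) * omega_pow (T (- (x * \<gamma>))))"
    by (subst sum.swap) (simp add: sum_distrib_right)
  also have "\<dots> = (\<Sum>x\<in>U. if p x = \<beta> then 3 ^ (2 * k) * omega_pow (T (- (x * \<gamma>))) else 0)"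
    using \<beta> by (intro sum.cong refl) (simp add: character_sum U_diff p_mem)
  finally have sum: "walsh (4 * k) F b = \<dots>" .
  obtain x where x: "x \<in> U" "p x = \<beta>"
    using p_bij \<beta> by (metis bij_betw_def imageE)
  have "p y = \<beta> \<longleftrightarrow> y = x" if "y \<in> U" for y
    using p_bij x that by (metis bij_betw_def inj_onD)
  then have "walsh (4 * k) F b = (\<Sum>y\<in>U. if y = x then 3 ^ (2 * k) * omega_pow (T (- (y * \<gamma>))) else 0)"
    unfolding sum by (intro sum.cong) auto
  also have "\<dots> = 3 ^ (2 * k) * omega_pow (T (- (x * \<gamma>)))"
    using x(1) by (simp add: sum.delta)
  finally show ?thesis
    using x(1) \<gamma> by (intro bexI[of _ "T (- (x * \<gamma>))"] T_mem U_minus U_mult)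
qed

lemma regular_bent_F: "regular_bent (4 * k) F"
proof -
  have "(cmod (walsh (4 * k) F b))\<^sup>2 = 3 ^ (4 * k)" for b
  proof -
    obtain c :: 'a where "walsh (4 * k) F b = 3 ^ (2 * k) * omega_pow c"
      using walsh_F by blast
    then have "(cmod (walsh (4 * k) F b))\<^sup>2 = (3 ^ (2 * k))\<^sup>2"
      by (simp add: norm_mult norm_power cmod_omega_pow)
    then show ?thesis by (simp flip: power_mult)
  qed
  moreover have "3 powr (- real (4 * k) / 2) = inverse (3 ^ (2 * k))"
  proof -
    have "- real (4 * k) / 2 = - real (2 * k)" by simp
    then show ?thesis by (simp only: powr_minus powr_realpow[OF zero_less_numeral])
  qed
  then have "of_real (3 powr (- real (4 * k) / 2)) * (3 ^ (2 * k) * x) = x" for x :: complex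
    by simp
  then have "\<exists>c\<in>(F3 :: 'a set). of_real (3 powr (- real (4 * k) / 2)) * walsh (4 * k) F b = omega_pow c" for b
    using walsh_F[of b] by metis
  ultimately show ?thesis
    by (simp only: regular_bent_def bent_def) simp
qed

text \<open>For the zero function the Walsh value at 0 would be the field size \<open>N\<close>, and
  bentness would give \<open>N\<^sup>2 = N\<close>. This guarantees that some exponent occurs in the
  reduced polynomial.\<close>

lemma F_not_zero: "\<exists>z. F z \<noteq> 0"
proof (rule ccontr)
  assume "\<not> ?thesis"
  then have "walsh (4 * k) F 0 = of_nat CARD('a)"
    by (simp add: walsh_def Tr_zero omega_pow_F3[OF char])
  moreover have "(cmod (walsh (4 * k) F 0))\<^sup>2 = 3 ^ (4 * k)"
    using regular_bent_F by (simp add: regular_bent_def bent_def)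
  ultimately have "(3 ^ (4 * k))\<^sup>2 = (3::real) ^ (4 * k)"
    by (simp add: card norm_power)
  then show False
    using k_pos one_less_power[of "3::real" "4 * k"] by (simp add: power2_eq_square)
qed


section \<open>The algebraic degree\<close>

lemma power3_mod: "(z::'a) ^ 3 ^ (j mod (4 * k)) = z ^ 3 ^ j"
proof -
  define N where "N = 4 * k"
  have "z ^ 3 ^ N = z"
    by (simp only: N_def power_card)
  then have "z ^ 3 ^ (N * i) = z" for i
    by (induction i) (simp_all add: power_add power_mult)
  then have "z ^ 3 ^ (N * (j div N) + j mod N) = z ^ 3 ^ (j mod N)"
    by (simp only: power_add power_mult)
  then show ?thesis by (simp add: N_def)
qed

text \<open>Exponents are reduced by wrapping the positions of the ternary digits modulo \<open>4 k\<close>.\<close>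

definition e1 :: "nat \<Rightarrow> nat" where
  "e1 i = 2 * 3 ^ i + 2 * 3 ^ ((i + k) mod (4 * k))"

definition e2 :: "nat \<Rightarrow> nat" where
  "e2 i = 3 ^ i + 2 * 3 ^ ((i + k) mod (4 * k)) + 3 ^ ((i + 2 * k) mod (4 * k))"

text \<open>The wrapped positions of \<open>i\<close>, \<open>i + k\<close> and
  \<open>i + 2 * k\<close> are distinct, so no carries occur and the digits add up as 2 + 2 and 1 +
  2 + 1.\<close>

lemma exponents:
  assumes "i < 4 * k"
  shows "digit_sum3 (e1 i) = 4" "e1 i < 3 ^ (4 * k)"
    and "digit_sum3 (e2 i) = 4" "e2 i < 3 ^ (4 * k)"
proof -
  define j l where "j = (i + k) mod (4 * k)" and "l = (i + 2 * k) mod (4 * k)"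
  \<comment> \<open>As \<open>i < 4 * k\<close>, each position wraps at most once.\<close>
  have "j = (if i + k < 4 * k then i + k else i + k - 4 * k)"
    "l = (if i + 2 * k < 4 * k then i + 2 * k else i + 2 * k - 4 * k)"
    using assms by (simp_all add: j_def l_def mod_if)
  then have distinct: "i \<noteq> j" "i \<noteq> l" "j \<noteq> l" "j \<noteq> i" "l \<noteq> i" "l \<noteq> j" and less: "j < 4 * k" "l < 4 * k"
    using assms k_pos by (auto split: if_splits)
  show "digit_sum3 (e1 i) = 4" "e1 i < 3 ^ (4 * k)"
    using digit_sum3_sparse[of "{i, j}" "4 * k" "\<lambda>_. 2"] assms distinct less
    by (simp_all add: e1_def flip: j_def)
  show "digit_sum3 (e2 i) = 4" "e2 i < 3 ^ (4 * k)"
    using digit_sum3_sparse[of "{i, j, l}" "4 * k" "\<lambda>x. if x = j then 2 else 1"] assms distinct less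
    by (simp_all add: e2_def add.assoc flip: j_def l_def)
qed

text \<open>Expanding the trace by Frobenius and wrapping exponents gives a polynomial
  \<open>P\<close> of degree below the field size, which is the reduced one by uniqueness. Possible
  cancellation is harmless: every surviving exponent has digit sum 4, and
  \<open>P \<noteq> 0\<close>.\<close>

lemma algebraic_degree_F: "algebraic_degree F = 4"
proof -
  define P where "P = (\<Sum>i<4 * k. monom ((a ^ 5) ^ 3 ^ i) (e1 i) + monom ((a powi (- 5)) ^ 3 ^ i) (e2 i))"
  have z1: "(z ^ (2 * (3 ^ k + 1))) ^ 3 ^ i = z ^ e1 i" for z :: 'a and i
  proof -
    have "z ^ e1 i = (z ^ 3 ^ i)\<^sup>2 * (z ^ 3 ^ (i + k))\<^sup>2"
      by (simp add: e1_def power_add power3_mod mult.commute[of 2] power_mult)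
    also have "\<dots> = z ^ (3 ^ i * 2 + 3 ^ (i + k) * 2)"
      by (simp only: power_add power_mult)
    also have "3 ^ i * 2 + 3 ^ (i + k) * 2 = 2 * (3 ^ k + 1) * (3::nat) ^ i"
      by (simp add: power_add algebra_simps)
    finally show ?thesis by (simp only: power_mult)
  qed
  have z2: "(z ^ ((3 ^ k + 1) ^ 2)) ^ 3 ^ i = z ^ e2 i" for z :: 'a and i
  proof -
    have "z ^ e2 i = z ^ 3 ^ i * (z ^ 3 ^ (i + k))\<^sup>2 * z ^ 3 ^ (i + 2 * k)"
      by (simp add: e2_def power_add power3_mod mult.commute[of 2] power_mult)
    also have "\<dots> = z ^ (3 ^ i + 3 ^ (i + k) * 2 + 3 ^ (i + 2 * k))"
      by (simp only: power_add power_mult)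
    also have "3 ^ i + 3 ^ (i + k) * 2 + 3 ^ (i + 2 * k) = (3 ^ k + 1) ^ 2 * (3::nat) ^ i"
      by (simp add: power_add mult_2_right power2_eq_square algebra_simps)
    finally show ?thesis by (simp only: power_mult)
  qed
  have poly: "poly P z = F z" for z
    unfolding P_def F_def Tr_def
    by (simp only: poly_sum poly_add poly_monom power3_add[OF char] power_mult_distrib z1 z2)
  have "degree P \<le> 3 ^ (4 * k) - 1"
  proof -
    have "e1 i \<le> 3 ^ (4 * k) - 1" "e2 i \<le> 3 ^ (4 * k) - 1" if "i < 4 * k" for i
      using exponents[OF that] by linarith+
    then show ?thesis
      unfolding P_def
      by (intro degree_sum_le degree_add_le order.trans[OF degree_monom_le]) auto
  qed
  then have "degree P < CARD('a)"
    unfolding card by (metis Suc_pred' le_imp_less_Suc zero_less_numeral zero_less_power)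
  then have red: "reduced_poly F = P"
    unfolding reduced_poly_def
    by (intro the1_equality reduced_poly_ex1) (auto simp: poly)
  have four: "digit_sum3 e = 4" if "coeff P e \<noteq> 0" for e
  proof -
    obtain i where "i < 4 * k" "e = e1 i \<or> e = e2 i"
    proof (rule ccontr)
      assume "\<not> thesis"
      then have "coeff P e = 0"
        using that unfolding P_def coeff_sum by (intro sum.neutral) auto
      with \<open>coeff P e \<noteq> 0\<close> show False ..
    qed
    then show ?thesis using exponents by auto
  qed
  have "P \<noteq> 0"
    using F_not_zero poly by (metis poly_0)
  then have "coeff P (degree P) \<noteq> 0" by simp
  \<comment> \<open>The leading exponent witnesses that the set is not empty.\<close>
  then have "digit_sum3 ` {e. coeff P e \<noteq> 0} = {4}"
    using four by (intro equalityI subsetI) (auto intro!: image_eqI[of _ _ "degree P"])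
  then show ?thesis
    by (simp add: algebraic_degree_def red)
qed

end

theorem theorem6:
  fixes n k :: nat
    and a a1 a2 :: "'a::{field, finite}"
    and f :: "'a \<Rightarrow> 'a"
  assumes "CARD('a) = 3 ^ n"
    and "n = 4 * k"
    and "k mod 4 = 1"
    and "a \<in> subfield_of_order (3 ^ 4)"
    and "a ^ 4 - a ^ 2 - 1 = 0"
    and "a1 = a ^ 5"
    and "a2 = a powi (- 5)"
    and "f = (\<lambda>x. Tr n (a1 * x ^ (2 * (3 ^ k + 1)) + a2 * x ^ ((3 ^ k + 1) ^ 2)))"
  shows "range f \<subseteq> F3 \<and> regular_bent n f \<and> algebraic_degree f = 4 \<and>
         maiorana_mcfarland (2 * k) f"
proof -
  interpret quartic_field k a
    using assms by unfold_locales (simp_all add: algebra_simps)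
  have f: "f = F"
    by (simp add: F_def[abs_def] assms)
  moreover have "range F \<subseteq> F3"
    by (auto simp: F_eq T_mem U_mult w_mem u_mem p_mem)
  ultimately show ?thesis
    using regular_bent_F algebraic_degree_F maiorana_mcfarland_F assms(2) by simp
qed

end
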